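(* Let $\mathbb{K}\in\{\mathbb{R},\mathbb{C}\}$ and let $\mathcal{T}\in\mathbb{K}^{I_1\times I_2\times I_3}$ be a third-order tensor. Let $\phi^{\mathrm{TH}}(\mathcal{T})$ and $\phi^{\mathrm{Se}}(\mathcal{T})$ be the rank-1 approximations of $\mathcal{T}$ delivered by the THOSVD algorithm and by the SeROAP algorithm, respectively. Then $$\|\mathcal{T}-\phi^{\mathrm{Se}}(\mathcal{T})\|\le\|\mathcal{T}-\phi^{\mathrm{TH}}(\mathcal{T})\|.$$
   Context: Notation. $\langle\mathcal{T},\mathcal{U}\rangle=\sum_{i_1,i_2,i_3}T_{i_1i_2i_3}U^*_{i_1i_2i_3}$, where $^*$ is entrywise complex conjugation, and $\|\cdot\|$ is the induced Frobenius norm. $\otimes$ is the tensor (outer) product, so $(a\otimes b\otimes c)_{i_1i_2i_3}=a_{i_1}b_{i_2}c_{i_3}$; $\boxtimes$ is the Kronecker product; $^H$ is conjugate transpose. $\operatorname{vec}$ stacks the columns of a matrix into a vector and $\operatorname{Unvec}$ is its inverse (for a prescribed matrix size). The mode-$n$ unfolding $T_{(n)}$ is the matrix whose row index is $i_n$ and whose columns are indexed by the remaining indices, the lower-numbered remaining index varying fastest; thus $T_{(1)}\in\mathbb{K}^{I_1\times I_2I_3}$ and the mode-1 unfolding of $a\otimes b\otimes c$ is $a(c\boxtimes b)^{\mathsf T}$. Singular vectors. For each matrix $M$ an SVD is fixed, with singular values in decreasing order. The first left and first right singular vectors of $M$ are the unit vectors $u,v$ associated with the largest singular value $\|M\|_2$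 in this SVD, so that $Mv=\|M\|_2u$ and $u^HM=\|M\|_2v^H$. The same SVD of $T_{(1)}$ is used in both algorithms. THOSVD (third order): for $n=1,2,3$ let $u_n$ be the first left singular vector of $T_{(n)}$. Set $\mathcal{U}=u_1\otimes u_2\otimes u_3$, $\lambda=\langle\mathcal{T},\mathcal{U}\rangle$, and output $\phi^{\mathrm{TH}}(\mathcal{T})=\lambda\,\mathcal{U}$. SeROAP (third order): let $v_1\in\mathbb{K}^{I_2I_3}$ be the first right singular vector of $T_{(1)}$, and let $V_1=\operatorname{Unvec}(v_1)\in\mathbb{K}^{I_2\times I_3}$. Let $u,v$ be the first left and right singular vectors of $V_1$, and put $w=v^*\boxtimes u$. Output the tensor $\phi^{\mathrm{Se}}(\mathcal{T})$ whose mode-1 unfolding is $(T_{(1)}w)w^H$. (The paper presents SeROAP with modes numbered so that $I_1\ge I_2\ge I_3$, without loss of generality; the definition does not use this ordering.) *)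

theory Defs
  imports "Jordan_Normal_Form.Schur_Decomposition" Complex_Main
begin

text \<open>
  Both scalar fields are handled inside \<^typ>\<open>complex\<close>: a set \<open>K\<close> which is either
  \<open>\<real>\<close> or \<open>UNIV\<close> collects the admissible entries. On \<open>\<real>\<close> complex conjugation is the
  identity, so all formulas below specialise correctly to the real field.

  Tensors are 0-based arrays; only the entries with indices below \<open>I1, I2, I3\<close> matter.
\<close>

type_synonym tensor3 = "nat \<Rightarrow> nat \<Rightarrow> nat \<Rightarrow> complex"

definition tensor_over :: "complex set \<Rightarrow> nat \<Rightarrow> nat \<Rightarrow> nat \<Rightarrow> tensor3 \<Rightarrow> bool" where
  "tensor_over K I1 I2 I3 T \<longleftrightarrow> (\<forall>i<I1. \<forall>j<I2. \<forall>k<I3. T i j k \<in> K)"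

definition tensor_inner :: "nat \<Rightarrow> nat \<Rightarrow> nat \<Rightarrow> tensor3 \<Rightarrow> tensor3 \<Rightarrow> complex" where
  "tensor_inner I1 I2 I3 T U = (\<Sum>i<I1. \<Sum>j<I2. \<Sum>k<I3. T i j k * cnj (U i j k))"

definition tensor_norm :: "nat \<Rightarrow> nat \<Rightarrow> nat \<Rightarrow> tensor3 \<Rightarrow> real" where
  "tensor_norm I1 I2 I3 T = sqrt (Re (tensor_inner I1 I2 I3 T T))"

definition outer3 :: "complex vec \<Rightarrow> complex vec \<Rightarrow> complex vec \<Rightarrow> tensor3" where
  "outer3 a b c = (\<lambda>i j k. a $ i * b $ j * c $ k)"

definition kron_vec :: "complex vec \<Rightarrow> complex vec \<Rightarrow> complex vec" where
  "kron_vec a b = vec (dim_vec a * dim_vec b) (\<lambda>k. a $ (k div dim_vec b) * b $ (k mod dim_vec b))"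

text \<open>The matrix \<open>x y\<^sup>H\<close>.\<close>

definition outer_conj :: "complex vec \<Rightarrow> complex vec \<Rightarrow> complex mat" where
  "outer_conj x y = mat (dim_vec x) (dim_vec y) (\<lambda>(i, j). x $ i * conjugate (y $ j))"

text \<open>Column-major inverse of \<open>vec\<close>, for an \<open>m \<times> n\<close> matrix.\<close>

definition unvec :: "nat \<Rightarrow> nat \<Rightarrow> complex vec \<Rightarrow> complex mat" where
  "unvec m n x = mat m n (\<lambda>(i, j). x $ (j * m + i))"

text \<open>In each unfolding the lower-numbered remaining index varies fastest.\<close>

definition unfold1 :: "nat \<Rightarrow> nat \<Rightarrow> nat \<Rightarrow> tensor3 \<Rightarrow> complex mat" where
  "unfold1 I1 I2 I3 T = mat I1 (I2 * I3) (\<lambda>(r, c). T r (c mod I2) (c div I2))"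

definition unfold2 :: "nat \<Rightarrow> nat \<Rightarrow> nat \<Rightarrow> tensor3 \<Rightarrow> complex mat" where
  "unfold2 I1 I2 I3 T = mat I2 (I1 * I3) (\<lambda>(r, c). T (c mod I1) r (c div I1))"

definition unfold3 :: "nat \<Rightarrow> nat \<Rightarrow> nat \<Rightarrow> tensor3 \<Rightarrow> complex mat" where
  "unfold3 I1 I2 I3 T = mat I3 (I1 * I2) (\<lambda>(r, c). T (c mod I1) (c div I1) r)"

text \<open>The tensor with a given mode-1 unfolding (cf. \<open>unfold1_fold1\<close>).\<close>

definition fold1 :: "nat \<Rightarrow> complex mat \<Rightarrow> tensor3" where
  "fold1 I2 M = (\<lambda>i j k. M $$ (i, k * I2 + j))"

lemma unfold1_fold1:
  assumes "M \<in> carrier_mat I1 (I2 * I3)"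
  shows "unfold1 I1 I2 I3 (fold1 I2 M) = M"
  using assms by (intro eq_matI) (auto simp: unfold1_def fold1_def)

lemma unfold1_outer3:
  assumes "a \<in> carrier_vec I1" "b \<in> carrier_vec I2" "c \<in> carrier_vec I3"
  shows "unfold1 I1 I2 I3 (outer3 a b c) = outer_conj a (conjugate (kron_vec c b))"
  using assms
  by (intro eq_matI) (auto simp: unfold1_def outer3_def outer_conj_def kron_vec_def mult.commute)

text \<open>
  Full singular value decomposition \<open>M = U S V\<^sup>H\<close> over \<open>K\<close>: \<open>U\<close> and \<open>V\<close> are unitary
  (orthogonal if \<open>K = \<real>\<close>) and \<open>S\<close> is rectangular diagonal, with nonnegative real diagonal
  in decreasing order.
\<close>

definition unitary_over :: "complex set \<Rightarrow> nat \<Rightarrow> complex mat \<Rightarrow> bool" where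
  "unitary_over K n U \<longleftrightarrow>
     U \<in> carrier_mat n n \<and> elements_mat U \<subseteq> K \<and> mat_adjoint U * U = 1\<^sub>m n"

definition is_svd ::
  "complex set \<Rightarrow> complex mat \<Rightarrow> complex mat \<times> complex mat \<times> complex mat \<Rightarrow> bool" where
  "is_svd K M = (\<lambda>(U, S, V).
     unitary_over K (dim_row M) U \<and> unitary_over K (dim_col M) V \<and>
     S \<in> carrier_mat (dim_row M) (dim_col M) \<and> diagonal_mat S \<and>
     (\<forall>i < min (dim_row M) (dim_col M). S $$ (i, i) \<in> \<real> \<and> 0 \<le> Re (S $$ (i, i))) \<and>
     (\<forall>i j. i \<le> j \<and> j < min (dim_row M) (dim_col M) \<longrightarrow> Re (S $$ (j, j)) \<le> Re (S $$ (i, i))) \<and>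
     M = U * S * mat_adjoint V)"

text \<open>
  A function \<open>svd\<close> assigning to every matrix over \<open>K\<close> one of its SVDs represents the fixed
  choice of decompositions on which the algorithms depend.
\<close>

type_synonym svd_choice = "complex mat \<Rightarrow> complex mat \<times> complex mat \<times> complex mat"

definition svd_choice_over :: "complex set \<Rightarrow> svd_choice \<Rightarrow> bool" where
  "svd_choice_over K svd \<longleftrightarrow> (\<forall>M. elements_mat M \<subseteq> K \<longrightarrow> is_svd K M (svd M))"

definition first_left_sv :: "svd_choice \<Rightarrow> complex mat \<Rightarrow> complex vec" where
  "first_left_sv svd M = (case svd M of (U, S, V) \<Rightarrow> col U 0)"

definition first_right_sv :: "svd_choice \<Rightarrow> complex mat \<Rightarrow> complex vec" where
  "first_right_sv svd M = (case svd M of (U, S, V) \<Rightarrow> col V 0)"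

definition thosvd :: "svd_choice \<Rightarrow> nat \<Rightarrow> nat \<Rightarrow> nat \<Rightarrow> tensor3 \<Rightarrow> tensor3" where
  "thosvd svd I1 I2 I3 T =
    (let u1 = first_left_sv svd (unfold1 I1 I2 I3 T);
         u2 = first_left_sv svd (unfold2 I1 I2 I3 T);
         u3 = first_left_sv svd (unfold3 I1 I2 I3 T);
         U = outer3 u1 u2 u3;
         l = tensor_inner I1 I2 I3 T U
     in (\<lambda>i j k. l * U i j k))"

definition seroap :: "svd_choice \<Rightarrow> nat \<Rightarrow> nat \<Rightarrow> nat \<Rightarrow> tensor3 \<Rightarrow> tensor3" where
  "seroap svd I1 I2 I3 T =
    (let T1 = unfold1 I1 I2 I3 T;
         v1 = first_right_sv svd T1;
         V1 = unvec I2 I3 v1;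
         u = first_left_sv svd V1;
         v = first_right_sv svd V1;
         w = kron_vec (conjugate v) u
     in fold1 I2 (outer_conj (T1 *\<^sub>v w) w))"

end

theory Submission
  imports Defs "HOL-Analysis.L2_Norm"
begin

text \<open>
  Each algorithm returns the tensor \<open>T\<close> projected orthogonally onto some subspace, so its
  squared error is \<open>\<parallel>T\<parallel>\<^sup>2\<close> minus the squared norm of its output
  (\<open>rank1_residual\<close>). For THOSVD the output has norm \<open>|\<lambda>|\<close>; for SeROAP it has norm
  \<open>\<parallel>M w\<parallel>\<close>, where \<open>M\<close> is the mode-1 unfolding. It therefore suffices to show
  \<open>|\<lambda>| \<le> \<parallel>M w\<parallel>\<close>, and both sides are compared with the same number.

  Let \<open>s\<close> be the largest singular value of \<open>M\<close>, with singular vectors \<open>u1\<close> and \<open>v1\<close>,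
  and \<open>t\<close> the largest singular value of the matrix \<open>V1\<close> obtained by reshaping \<open>v1\<close>.
  THOSVD uses \<open>u1\<close> and SeROAP uses \<open>v1\<close>; since both come from one decomposition, they
  are tied by \<open>u1\<^sup>H M = s v1\<^sup>H\<close>. Contracting the first mode of \<open>T\<close>
  with the conjugate of \<open>u1\<close> thus leaves \<open>s\<close> times the conjugate of \<open>V1\<close>: a problem about a
  rank-1 approximation of a tensor has become one about a matrix. For THOSVD this gives
  \<open>|\<lambda>| = s |u2\<^sup>T V1 u3| \<le> s t\<close>, as \<open>u2\<close> and \<open>u3\<close> are unit vectors. SeROAP
  instead uses the optimal pair of \<open>V1\<close>, so that \<open>|u1\<^sup>H M w| = s t\<close>, and the
  Cauchy-Schwarz inequality gives \<open>s t \<le> \<parallel>M w\<parallel>\<close>.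

  All that is needed about singular value decompositions is collected in
  \<open>svd_first_singular_pair\<close>.
\<close>

section \<open>Euclidean norm and adjoint\<close>

definition vnorm :: "complex vec \<Rightarrow> real" where
  "vnorm x = L2_set (\<lambda>i. cmod (x $ i)) {0..<dim_vec x}"

lemma vnorm_nonneg [simp]: "0 \<le> vnorm x"
  by (simp add: vnorm_def L2_set_nonneg)

lemma vnorm_power2: "(vnorm x)\<^sup>2 = (\<Sum>i<dim_vec x. (cmod (x $ i))\<^sup>2)"
  by (simp add: vnorm_def L2_set_def sum_nonneg atLeast0LessThan)

lemma cscalar_prod_self: "x \<bullet>c x = of_real ((vnorm x)\<^sup>2)"
  by (simp add: vnorm_power2 scalar_prod_def conjugate_complex_def complex_norm_square
      atLeast0LessThan del: of_real_power)

lemma vnorm_eq_of_cscalar_prod: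
  assumes "x \<bullet>c x = y \<bullet>c y"
  shows "vnorm x = vnorm y"
proof -
  have "(vnorm x)\<^sup>2 = (vnorm y)\<^sup>2"
    using assms unfolding cscalar_prod_self of_real_eq_iff .
  then show ?thesis by simp
qed

lemma vnorm_conjugate [simp]: "vnorm (conjugate x) = vnorm x"
  by (simp add: vnorm_def L2_set_def conjugate_complex_def)

lemma cauchy_schwarz:
  assumes "x \<in> carrier_vec n" "y \<in> carrier_vec n"
  shows "cmod (x \<bullet>c y) \<le> vnorm x * vnorm y"
proof -
  have "cmod (x \<bullet>c y) \<le> (\<Sum>i\<in>{0..<n}. cmod (x $ i) * cmod (y $ i))"
    using assms norm_sum[of "\<lambda>i. x $ i * cnj (y $ i)" "{0..<n}"]
    by (simp add: scalar_prod_def conjugate_complex_def norm_mult)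
  also have "\<dots> \<le> vnorm x * vnorm y"
    using assms L2_set_mult_ineq[of "\<lambda>i. cmod (x $ i)" "\<lambda>i. cmod (y $ i)" "{0..<n}"]
    by (simp add: vnorm_def)
  finally show ?thesis .
qed

lemma mat_adjoint_carrier [simp]:
  "A \<in> carrier_mat m n \<Longrightarrow> mat_adjoint A \<in> carrier_mat n m"
  by (auto simp: mat_adjoint_def mat_of_rows_def)

lemma dim_mat_adjoint [simp]:
  fixes A :: "complex mat"
  shows "dim_row (mat_adjoint A) = dim_col A" "dim_col (mat_adjoint A) = dim_row A"
  by (simp_all add: mat_adjoint_def)

lemma mat_adjoint_index:
  fixes A :: "complex mat"
  assumes "i < dim_col A" "j < dim_row A"
  shows "mat_adjoint A $$ (i, j) = cnj (A $$ (j, i))"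
  using assms by (simp add: mat_adjoint_def mat_of_rows_def conjugate_complex_def)

lemma cscalar_prod_adjoint:
  fixes A :: "complex mat"
  assumes "A \<in> carrier_mat m n" "x \<in> carrier_vec m" "y \<in> carrier_vec n"
  shows "(A *\<^sub>v y) \<bullet>c x = y \<bullet>c (mat_adjoint A *\<^sub>v x)"
proof -
  have "mat_adjoint A \<in> carrier_mat n m" using assms by simp
  then have "y \<bullet>c (mat_adjoint A *\<^sub>v x)
      = (\<Sum>j<n. \<Sum>i<m. y $ j * (A $$ (i, j) * cnj (x $ i)))"
    using assms
    by (simp add: scalar_prod_def conjugate_complex_def mat_adjoint_index
        sum_distrib_left atLeast0LessThan)
  moreover have "(A *\<^sub>v y) \<bullet>c x = (\<Sum>i<m. \<Sum>j<n. y $ j * (A $$ (i, j) * cnj (x $ i)))"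
    using assms
    by (simp add: scalar_prod_def conjugate_complex_def sum_distrib_left atLeast0LessThan ac_simps)
  ultimately show ?thesis by (simp only: sum.swap[of _ "{..<n}" "{..<m}"])
qed

lemma isometry_vnorm:
  fixes A :: "complex mat"
  assumes "A \<in> carrier_mat m n" "mat_adjoint A * A = 1\<^sub>m n" "x \<in> carrier_vec n"
  shows "vnorm (A *\<^sub>v x) = vnorm x"
proof (rule vnorm_eq_of_cscalar_prod)
  have c: "mat_adjoint A \<in> carrier_mat n m" using assms by simp
  have "(A *\<^sub>v x) \<bullet>c (A *\<^sub>v x) = x \<bullet>c (mat_adjoint A *\<^sub>v (A *\<^sub>v x))"
    using assms by (intro cscalar_prod_adjoint) auto
  also have "mat_adjoint A *\<^sub>v (A *\<^sub>v x) = x"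
    using assms assoc_mult_mat_vec[OF c assms(1,3)] by simp
  finally show "(A *\<^sub>v x) \<bullet>c (A *\<^sub>v x) = x \<bullet>c x" .
qed

lemma mat_adjoint_adjoint: "mat_adjoint (mat_adjoint A) = (A :: complex mat)"
  by (intro eq_matI) (auto simp: mat_adjoint_index)

section \<open>The leading singular pair\<close>

lemma diagonal_vnorm_le:
  fixes S :: "complex mat"
  assumes S: "S \<in> carrier_mat m n" "diagonal_mat S" and y: "y \<in> carrier_vec n" and s: "0 \<le> s"
    and le: "\<And>i. i < min m n \<Longrightarrow> cmod (S $$ (i, i)) \<le> s"
  shows "vnorm (S *\<^sub>v y) \<le> s * vnorm y"
proof (rule power2_le_imp_le)
  have e: "(S *\<^sub>v y) $ i = (if i < n then S $$ (i, i) * y $ i else 0)" if "i < m" for i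
  proof -
    have "(S *\<^sub>v y) $ i = (\<Sum>j<n. S $$ (i, j) * y $ j)"
      using S y that by (simp add: scalar_prod_def atLeast0LessThan)
    also have "\<dots> = (\<Sum>j<n. if j = i then S $$ (i, i) * y $ i else 0)"
      using S that by (intro sum.cong) (auto simp: diagonal_mat_def)
    finally show ?thesis by simp
  qed
  have "(vnorm (S *\<^sub>v y))\<^sup>2 = (\<Sum>i<m. (cmod ((S *\<^sub>v y) $ i))\<^sup>2)"
    using S by (simp add: vnorm_power2)
  also have "\<dots> = (\<Sum>i<m. if i < n then (cmod (S $$ (i, i) * y $ i))\<^sup>2 else 0)"
    by (intro sum.cong) (auto simp: e)
  also have "\<dots> = (\<Sum>i<min m n. (cmod (S $$ (i, i) * y $ i))\<^sup>2)"
    by (subst sum.If_cases) (auto intro!: sum.cong)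
  also have "\<dots> \<le> (\<Sum>i<min m n. s\<^sup>2 * (cmod (y $ i))\<^sup>2)"
    using le s by (intro sum_mono) (auto simp: norm_mult power_mult_distrib intro!: mult_right_mono power_mono)
  also have "\<dots> \<le> (\<Sum>i<n. s\<^sup>2 * (cmod (y $ i))\<^sup>2)"
    by (intro sum_mono2) auto
  also have "\<dots> = (s * vnorm y)\<^sup>2"
    using y by (simp add: vnorm_power2 power_mult_distrib sum_distrib_left)
  finally show "(vnorm (S *\<^sub>v y))\<^sup>2 \<le> (s * vnorm y)\<^sup>2" .
qed (use s in simp)

lemma unitary_col_vnorm:
  assumes "unitary_over K n U" "0 < n"
  shows "vnorm (col U 0) = 1"
proof -
  have U: "U \<in> carrier_mat n n" "mat_adjoint U * U = 1\<^sub>m n"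
    using assms by (auto simp: unitary_over_def)
  have "col U 0 = U *\<^sub>v unit_vec n 0"
    using U assms by (intro eq_vecI) auto
  then have "vnorm (col U 0) = vnorm (U *\<^sub>v unit_vec n 0)" by simp
  also have "\<dots> = vnorm (unit_vec n 0 :: complex vec)"
    using U by (intro isometry_vnorm) auto
  also have "\<dots> = 1"
    using assms by (simp add: vnorm_def L2_set_def unit_vec_def if_distrib[of cmod] if_distrib[of "\<lambda>x. x\<^sup>2"] cong: if_cong)
  finally show ?thesis .
qed

text \<open>
  The SVD \<open>M = U S V\<^sup>H\<close> gives \<open>U\<^sup>H M = S V\<^sup>H\<close>, whose row 0 is the relation
  \<open>u\<^sup>H M = s v\<^sup>H\<close>. The bound on \<open>\<parallel>M y\<parallel>\<close> holds because \<open>U\<close> and \<open>V\<^sup>H\<close> preserve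
  norms and no diagonal entry of \<open>S\<close> exceeds the first one. The entries of \<open>v\<close> are asserted
  to lie in \<open>K\<close> so that the reshaped \<open>v\<close> is again a matrix to which the choice of
  decompositions applies.
\<close>

lemma svd_first_singular_pair:
  fixes svd :: svd_choice
  assumes svd: "svd_choice_over K svd" and MK: "elements_mat M \<subseteq> K"
    and M: "M \<in> carrier_mat m n" and "0 < m" "0 < n"
  defines "u \<equiv> first_left_sv svd M" and "v \<equiv> first_right_sv svd M"
  obtains s where "0 \<le> s"
    and "u \<in> carrier_vec m" "vnorm u = 1"
    and "v \<in> carrier_vec n" "vnorm v = 1" "\<And>c. c < n \<Longrightarrow> v $ c \<in> K"
    and "\<And>c. c < n \<Longrightarrow> (\<Sum>r<m. cnj (u $ r) * M $$ (r, c)) = of_real s * cnj (v $ c)"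
    and "\<And>y. y \<in> carrier_vec n \<Longrightarrow> vnorm (M *\<^sub>v y) \<le> s * vnorm y"
proof -
  obtain U S V where USV: "svd M = (U, S, V)" by (cases "svd M")
  have "is_svd K M (U, S, V)" using svd MK USV by (auto simp: svd_choice_over_def)
  then have uU: "unitary_over K m U" and uV: "unitary_over K n V"
    and S: "S \<in> carrier_mat m n" "diagonal_mat S"
    and S_real: "\<And>i. i < min m n \<Longrightarrow> S $$ (i, i) \<in> \<real> \<and> 0 \<le> Re (S $$ (i, i))"
    and S_dec: "\<And>i j. i \<le> j \<Longrightarrow> j < min m n \<Longrightarrow> Re (S $$ (j, j)) \<le> Re (S $$ (i, i))"
    and dec: "M = U * S * mat_adjoint V"
    using M by (auto simp: is_svd_def)
  have U: "U \<in> carrier_mat m m" "mat_adjoint U * U = 1\<^sub>m m"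
    and V: "V \<in> carrier_mat n n" "mat_adjoint V * V = 1\<^sub>m n" "elements_mat V \<subseteq> K"
    using uU uV by (auto simp: unitary_over_def)
  have aU: "mat_adjoint U \<in> carrier_mat m m" and aV: "mat_adjoint V \<in> carrier_mat n n"
    using U V by auto
  have VV: "V * mat_adjoint V = 1\<^sub>m n"
    using mat_mult_left_right_inverse[OF aV V(1,2)] .
  define s where "s = Re (S $$ (0, 0))"
  have u: "u = col U 0" and v: "v = col V 0"
    by (auto simp: u_def v_def first_left_sv_def first_right_sv_def USV)
  show thesis
  proof (rule that[of s])
    show s0: "0 \<le> s" using S_real[of 0] assms by (simp add: s_def)
    show "u \<in> carrier_vec m" "v \<in> carrier_vec n" using U V by (auto simp: u v)
    show "vnorm u = 1" "vnorm v = 1"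
      using unitary_col_vnorm[OF uU] unitary_col_vnorm[OF uV] assms(4,5) by (simp_all add: u v)
    show "v $ c \<in> K" if "c < n" for c
      using V elements_matI[OF V(1) that assms(5) refl] that assms(5) by (auto simp: v)
    have UM: "mat_adjoint U * M = S * mat_adjoint V"
    proof -
      have "mat_adjoint U * M = mat_adjoint U * (U * (S * mat_adjoint V))"
        unfolding dec using U S aV by (simp add: assoc_mult_mat[of _ m m _ n _ n])
      also have "\<dots> = (mat_adjoint U * U) * (S * mat_adjoint V)"
        using U S aV aU by (intro assoc_mult_mat[symmetric]) auto
      finally show ?thesis using U S aV by simp
    qed
    show "(\<Sum>r<m. cnj (u $ r) * M $$ (r, c)) = of_real s * cnj (v $ c)" if c: "c < n" for c
    proof -
      have "(\<Sum>r<m. cnj (u $ r) * M $$ (r, c)) = (mat_adjoint U * M) $$ (0, c)"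
        using U(1) M aU c assms(4)
        unfolding u by (simp add: times_mat_def scalar_prod_def mat_adjoint_index atLeast0LessThan)
      also have "\<dots> = (\<Sum>j<n. S $$ (0, j) * cnj (V $$ (c, j)))"
        unfolding UM using V S aV c assms
        by (simp add: times_mat_def scalar_prod_def mat_adjoint_index atLeast0LessThan)
      also have "\<dots> = (\<Sum>j<n. if j = 0 then S $$ (0, 0) * cnj (V $$ (c, 0)) else 0)"
        using S assms by (intro sum.cong) (auto simp: diagonal_mat_def)
      also have "\<dots> = of_real s * cnj (v $ c)"
        using S_real[of 0] V(1) c assms(4,5) unfolding v by (auto simp: s_def)
      finally show ?thesis .
    qed
    show "vnorm (M *\<^sub>v y) \<le> s * vnorm y" if y: "y \<in> carrier_vec n" for y
    proof -
      define b where "b = mat_adjoint V *\<^sub>v y"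
      have b: "b \<in> carrier_vec n" using aV y by (simp add: b_def)
      have "M *\<^sub>v y = U *\<^sub>v (S *\<^sub>v b)"
        unfolding dec b_def using U S aV y
        by (simp add: assoc_mult_mat_vec[of _ m n _ n] assoc_mult_mat_vec[of _ m m _ n])
      then have "vnorm (M *\<^sub>v y) = vnorm (S *\<^sub>v b)"
        using isometry_vnorm[OF U, of "S *\<^sub>v b"] S b by simp
      also have "\<dots> \<le> s * vnorm b"
      proof (rule diagonal_vnorm_le[OF S b s0])
        fix i assume i: "i < min m n"
        then have "cmod (S $$ (i, i)) = Re (S $$ (i, i))"
          using S_real[OF i] by (auto elim!: Reals_cases)
        then show "cmod (S $$ (i, i)) \<le> s"
          using S_dec[of 0 i] i by (simp add: s_def)
      qed
      also have "vnorm b = vnorm y"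
        unfolding b_def using aV VV y by (intro isometry_vnorm) (auto simp: mat_adjoint_adjoint)
      finally show ?thesis .
    qed
  qed
qed

section \<open>Errors of rank-1 approximations\<close>

text \<open>
  Pythagoras: the hypothesis says that \<open>T - X\<close> is orthogonal to \<open>X\<close>.
\<close>

lemma tensor_inner_diff_self:
  assumes "tensor_inner I1 I2 I3 T X = tensor_inner I1 I2 I3 X X"
  shows "tensor_inner I1 I2 I3 (T - X) (T - X)
    = tensor_inner I1 I2 I3 T T - tensor_inner I1 I2 I3 X X"
proof -
  have XT: "tensor_inner I1 I2 I3 X T = cnj (tensor_inner I1 I2 I3 T X)"
    by (simp add: tensor_inner_def mult.commute)
  have XX: "cnj (tensor_inner I1 I2 I3 X X) = tensor_inner I1 I2 I3 X X"
    by (simp add: tensor_inner_def mult.commute)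
  have "tensor_inner I1 I2 I3 (T - X) (T - X)
    = tensor_inner I1 I2 I3 T T - tensor_inner I1 I2 I3 T X
      - tensor_inner I1 I2 I3 X T + tensor_inner I1 I2 I3 X X"
    by (simp add: tensor_inner_def algebra_simps sum.distrib sum_subtractf)
  then show ?thesis by (simp add: XT XX assms)
qed

lemma tensor_inner_outer3_self:
  assumes "a \<in> carrier_vec I1" "b \<in> carrier_vec I2" "c \<in> carrier_vec I3"
  shows "tensor_inner I1 I2 I3 (outer3 a b c) (outer3 a b c)
    = of_real ((vnorm a * vnorm b * vnorm c)\<^sup>2)"
proof -
  have "tensor_inner I1 I2 I3 (outer3 a b c) (outer3 a b c)
    = (\<Sum>i<I1. \<Sum>j<I2. \<Sum>k<I3. of_real ((cmod (a $ i))\<^sup>2) * of_real ((cmod (b $ j))\<^sup>2) * of_real ((cmod (c $ k))\<^sup>2))"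
    unfolding tensor_inner_def outer3_def complex_norm_square
    by (intro sum.cong refl) (simp add: algebra_simps)
  also have "\<dots> = of_real ((vnorm a)\<^sup>2 * (vnorm b)\<^sup>2 * (vnorm c)\<^sup>2)"
    using assms
    by (simp add: vnorm_power2 sum_distrib_left[symmetric] sum_distrib_right[symmetric]
        del: of_real_power)
  finally show ?thesis by (simp add: power_mult_distrib)
qed

text \<open>
  The inner product is arranged with the contraction of the first mode innermost, where
  \<open>u\<^sup>H M = s v\<^sup>H\<close> will be substituted.
\<close>

lemma tensor_inner_outer3:
  "tensor_inner I1 I2 I3 T (outer3 a b c)
    = (\<Sum>j<I2. \<Sum>k<I3. (\<Sum>i<I1. cnj (a $ i) * T i j k) * cnj (b $ j) * cnj (c $ k))"
proof -
  have "tensor_inner I1 I2 I3 T (outer3 a b c)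
     = (\<Sum>i<I1. \<Sum>j<I2. \<Sum>k<I3. cnj (a $ i) * T i j k * cnj (b $ j) * cnj (c $ k))"
    by (simp add: tensor_inner_def outer3_def ac_simps)
  also have "\<dots> = (\<Sum>j<I2. \<Sum>i<I1. \<Sum>k<I3. cnj (a $ i) * T i j k * cnj (b $ j) * cnj (c $ k))"
    by (rule sum.swap)
  also have "\<dots> = (\<Sum>j<I2. \<Sum>k<I3. \<Sum>i<I1. cnj (a $ i) * T i j k * cnj (b $ j) * cnj (c $ k))"
    by (rule sum.cong[OF refl], rule sum.swap)
  finally show ?thesis by (simp add: sum_distrib_right)
qed

text \<open>
  The column \<open>k * I2 + j\<close> of the mode-1 unfolding carries the index pair \<open>(j, k)\<close>.
\<close>

lemma index_pair_less: "k * m + j < m * (n::nat)" if "j < m" "k < n"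
proof -
  have "k * m + j < Suc k * m" using that by simp
  also have "\<dots> \<le> n * m" using that by (intro mult_le_mono1) simp
  finally show ?thesis by (simp add: mult.commute)
qed

lemma sum_index_pair:
  fixes f :: "nat \<Rightarrow> 'a::comm_monoid_add"
  shows "(\<Sum>c<m * n. f c) = (\<Sum>j<m. \<Sum>k<n. f (k * m + j))"
proof -
  have "(\<Sum>c<m * n. f c) = (\<Sum>k<n. sum f {k * m..<k * m + m})"
    by (simp add: sum.nat_group mult.commute)
  also have "\<dots> = (\<Sum>k<n. \<Sum>j<m. f (k * m + j))"
  proof (rule sum.cong[OF refl])
    fix k
    show "sum f {k * m..<k * m + m} = (\<Sum>j<m. f (k * m + j))"
      using sum.shift_bounds_nat_ivl[of f 0 "k * m" m]
      by (simp add: atLeast0LessThan add.commute)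
  qed
  also have "\<dots> = (\<Sum>j<m. \<Sum>k<n. f (k * m + j))" by (rule sum.swap)
  finally show ?thesis .
qed

lemma unfold1_mult_kron_vec:
  assumes "b \<in> carrier_vec I2" "c \<in> carrier_vec I3"
  shows "unfold1 I1 I2 I3 T *\<^sub>v kron_vec c b
    = vec I1 (\<lambda>i. \<Sum>j<I2. \<Sum>k<I3. T i j k * b $ j * c $ k)"
proof (rule eq_vecI)
  fix i assume "i < dim_vec (vec I1 (\<lambda>i. \<Sum>j<I2. \<Sum>k<I3. T i j k * b $ j * c $ k))"
  then have i: "i < I1" by simp
  have "(unfold1 I1 I2 I3 T *\<^sub>v kron_vec c b) $ i
    = (\<Sum>l<I2 * I3. T i (l mod I2) (l div I2) * (c $ (l div I2) * b $ (l mod I2)))"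
    using i assms
    by (simp add: unfold1_def kron_vec_def scalar_prod_def atLeast0LessThan mult.commute)
  also have "\<dots> = (\<Sum>j<I2. \<Sum>k<I3. T i j k * b $ j * c $ k)"
    by (subst sum_index_pair) (auto intro!: sum.cong)
  finally show "(unfold1 I1 I2 I3 T *\<^sub>v kron_vec c b) $ i
    = vec I1 (\<lambda>i. \<Sum>j<I2. \<Sum>k<I3. T i j k * b $ j * c $ k) $ i"
    using i by simp
qed (simp add: unfold1_def)

lemma tensor_inner_cong:
  assumes "\<And>i j k. i < I1 \<Longrightarrow> j < I2 \<Longrightarrow> k < I3 \<Longrightarrow> X i j k = Y i j k"
    and "\<And>i j k. i < I1 \<Longrightarrow> j < I2 \<Longrightarrow> k < I3 \<Longrightarrow> X' i j k = Y' i j k"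
  shows "tensor_inner I1 I2 I3 X X' = tensor_inner I1 I2 I3 Y Y'"
  unfolding tensor_inner_def using assms by (intro sum.cong refl) auto

text \<open>
  The outputs of the algorithms are functions on all index triples and agree with an outer
  product only inside the index box, since vector entries beyond the dimension are
  arbitrary. This is why \<open>X\<close> is kept apart from \<open>outer3 a b c\<close>.
\<close>

lemma rank1_residual:
  assumes X: "\<And>i j k. i < I1 \<Longrightarrow> j < I2 \<Longrightarrow> k < I3 \<Longrightarrow> X i j k = outer3 a b c i j k"
    and a: "a \<in> carrier_vec I1"
    and b: "b \<in> carrier_vec I2" "vnorm b = 1"
    and c: "c \<in> carrier_vec I3" "vnorm c = 1"
    and TX: "tensor_inner I1 I2 I3 T (outer3 a b c) = of_real ((vnorm a)\<^sup>2)"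
  shows "tensor_norm I1 I2 I3 (T - X) = sqrt (Re (tensor_inner I1 I2 I3 T T) - (vnorm a)\<^sup>2)"
proof -
  let ?R = "outer3 a b c"
  have "tensor_inner I1 I2 I3 (T - X) (T - X) = tensor_inner I1 I2 I3 (T - ?R) (T - ?R)"
    using X by (intro tensor_inner_cong) auto
  also have "\<dots> = tensor_inner I1 I2 I3 T T - of_real ((vnorm a)\<^sup>2)"
    using tensor_inner_outer3_self[OF a b(1) c(1)] TX b c
    by (subst tensor_inner_diff_self) auto
  finally show ?thesis by (simp add: tensor_norm_def)
qed

text \<open>
  Since \<open>w = v\<^sup>* \<boxtimes> u\<close>, the tensor with unfolding \<open>z w\<^sup>H\<close> is
  \<open>z \<otimes> u\<^sup>* \<otimes> v\<close>. Its inner product with \<open>T\<close> is \<open>\<parallel>z\<parallel>\<^sup>2\<close> because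
  \<open>z = M w\<close> is itself the contraction of \<open>T\<close> with \<open>u\<close> and \<open>v\<^sup>*\<close>.
\<close>

lemma seroap_residual:
  fixes T :: tensor3 and I1 I2 I3 :: nat
  assumes u: "u \<in> carrier_vec I2" "vnorm u = 1" and v: "v \<in> carrier_vec I3" "vnorm v = 1"
  defines "w \<equiv> kron_vec (conjugate v) u"
  defines "z \<equiv> unfold1 I1 I2 I3 T *\<^sub>v w"
  shows "tensor_norm I1 I2 I3 (T - fold1 I2 (outer_conj z w))
    = sqrt (Re (tensor_inner I1 I2 I3 T T) - (vnorm z)\<^sup>2)"
proof (rule rank1_residual)
  have z: "z = vec I1 (\<lambda>i. \<Sum>j<I2. \<Sum>k<I3. T i j k * u $ j * cnj (v $ k))"
    using u v unfolding z_def w_def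
    by (subst unfold1_mult_kron_vec) (auto simp: conjugate_complex_def)
  show zc: "z \<in> carrier_vec I1" by (simp add: z)
  show "conjugate u \<in> carrier_vec I2" "vnorm (conjugate u) = 1" using u by auto
  show "v \<in> carrier_vec I3" "vnorm v = 1" by fact+
  show "fold1 I2 (outer_conj z w) i j k = outer3 z (conjugate u) v i j k"
    if "i < I1" "j < I2" "k < I3" for i j k
    using that u v zc index_pair_less[of j I2 k I3]
    by (simp add: fold1_def outer_conj_def outer3_def w_def kron_vec_def conjugate_complex_def
        mult.commute[of I3])
  have "tensor_inner I1 I2 I3 T (outer3 z (conjugate u) v) = z \<bullet>c z"
  proof -
    have "tensor_inner I1 I2 I3 T (outer3 z (conjugate u) v)
      = (\<Sum>i<I1. (\<Sum>j<I2. \<Sum>k<I3. T i j k * u $ j * cnj (v $ k)) * cnj (z $ i))"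
      using u by (simp add: tensor_inner_def outer3_def conjugate_complex_def
          sum_distrib_left ac_simps)
    also have "\<dots> = z \<bullet>c z"
      by (simp add: z scalar_prod_def conjugate_complex_def atLeast0LessThan)
    finally show ?thesis .
  qed
  then show "tensor_inner I1 I2 I3 T (outer3 z (conjugate u) v) = of_real ((vnorm z)\<^sup>2)"
    by (simp only: cscalar_prod_self)
qed

lemma scaled_rank1_residual:
  fixes T :: tensor3 and I1 I2 I3 :: nat
  assumes a: "a \<in> carrier_vec I1" "vnorm a = 1"
    and b: "b \<in> carrier_vec I2" "vnorm b = 1"
    and c: "c \<in> carrier_vec I3" "vnorm c = 1"
  defines "l \<equiv> tensor_inner I1 I2 I3 T (outer3 a b c)"
  shows "tensor_norm I1 I2 I3 (T - (\<lambda>i j k. l * outer3 a b c i j k))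
    = sqrt (Re (tensor_inner I1 I2 I3 T T) - (cmod l)\<^sup>2)"
proof -
  have n: "vnorm (l \<cdot>\<^sub>v a) = cmod l"
  proof -
    have "vnorm (l \<cdot>\<^sub>v a) = L2_set (\<lambda>i. cmod l * cmod (a $ i)) {0..<I1}"
      unfolding vnorm_def using a by (intro L2_set_cong) (auto simp: norm_mult)
    also have "\<dots> = cmod l * vnorm a"
      using a L2_set_right_distrib[of "cmod l" "\<lambda>i. cmod (a $ i)" "{0..<I1}"]
      by (simp add: vnorm_def)
    finally show ?thesis using a by simp
  qed
  have "tensor_norm I1 I2 I3 (T - (\<lambda>i j k. l * outer3 a b c i j k))
    = sqrt (Re (tensor_inner I1 I2 I3 T T) - (vnorm (l \<cdot>\<^sub>v a))\<^sup>2)"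
  proof (rule rank1_residual[OF _ _ b c])
    show "l \<cdot>\<^sub>v a \<in> carrier_vec I1" using a by simp
    show "l * outer3 a b c i j k = outer3 (l \<cdot>\<^sub>v a) b c i j k" if "i < I1" for i j k
      using a that by (simp add: outer3_def)
    have "tensor_inner I1 I2 I3 T (outer3 (l \<cdot>\<^sub>v a) b c)
      = (\<Sum>i<I1. \<Sum>j<I2. \<Sum>k<I3. cnj l * (T i j k * cnj (outer3 a b c i j k)))"
      unfolding tensor_inner_def using a
      by (intro sum.cong refl) (simp add: outer3_def)
    also have "\<dots> = cnj l * l"
      by (simp add: l_def tensor_inner_def sum_distrib_left)
    also have "\<dots> = of_real ((cmod l)\<^sup>2)"
      by (simp add: complex_norm_square mult.commute del: of_real_power)
    finally show "tensor_inner I1 I2 I3 T (outer3 (l \<cdot>\<^sub>v a) b c) = of_real ((vnorm (l \<cdot>\<^sub>v a))\<^sup>2)"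
      by (simp add: n)
  qed
  then show ?thesis by (simp add: n)
qed

section \<open>Comparison of SeROAP and THOSVD\<close>

theorem mainTheorem1:
  fixes K :: "complex set" and I1 I2 I3 :: nat and T :: tensor3 and svd :: svd_choice
  assumes "K = \<real> \<or> K = UNIV"
    and "I1 \<ge> 1" and "I2 \<ge> 1" and "I3 \<ge> 1"
    and "tensor_over K I1 I2 I3 T"
    and "svd_choice_over K svd"
  shows "tensor_norm I1 I2 I3 (T - seroap svd I1 I2 I3 T)
       \<le> tensor_norm I1 I2 I3 (T - thosvd svd I1 I2 I3 T)"
proof -
  define M where "M = unfold1 I1 I2 I3 T"
  have TK: "T i j k \<in> K" if "i < I1" "j < I2" "k < I3" for i j k
    using assms(5) that by (auto simp: tensor_over_def)
  have mod_less: "c mod m < m" "c div m < n" if "c < m * n" for c m n :: nat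
    using that less_mult_imp_div_less[of c n m] by (cases "m = 0"; simp add: mult.commute)+
  have M: "M \<in> carrier_mat I1 (I2 * I3)" "elements_mat M \<subseteq> K"
    by (auto simp: M_def unfold1_def intro!: TK mod_less dest!: elements_matD)
  have M2: "unfold2 I1 I2 I3 T \<in> carrier_mat I2 (I1 * I3)" "elements_mat (unfold2 I1 I2 I3 T) \<subseteq> K"
    by (auto simp: unfold2_def intro!: TK mod_less dest!: elements_matD)
  have M3: "unfold3 I1 I2 I3 T \<in> carrier_mat I3 (I1 * I2)" "elements_mat (unfold3 I1 I2 I3 T) \<subseteq> K"
    by (auto simp: unfold3_def intro!: TK mod_less dest!: elements_matD)
  have pos: "0 < I1" "0 < I2" "0 < I3" "0 < I2 * I3" "0 < I1 * I3" "0 < I1 * I2"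
    using assms by auto

  define u1 where "u1 = first_left_sv svd M"
  define v1 where "v1 = first_right_sv svd M"
  obtain s where s: "0 \<le> s" and u1: "u1 \<in> carrier_vec I1" "vnorm u1 = 1"
    and v1K: "\<And>c. c < I2 * I3 \<Longrightarrow> v1 $ c \<in> K"
    and u1M: "\<And>c. c < I2 * I3 \<Longrightarrow> (\<Sum>r<I1. cnj (u1 $ r) * M $$ (r, c)) = of_real s * cnj (v1 $ c)"
    unfolding u1_def v1_def
    by (rule svd_first_singular_pair[OF assms(6) M(2,1)]) (use pos in auto)
  obtain u2 where u2_eq: "u2 = first_left_sv svd (unfold2 I1 I2 I3 T)"
    and u2: "u2 \<in> carrier_vec I2" "vnorm u2 = 1"
    by (rule svd_first_singular_pair[OF assms(6) M2(2,1)]) (use pos in auto)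
  obtain u3 where u3_eq: "u3 = first_left_sv svd (unfold3 I1 I2 I3 T)"
    and u3: "u3 \<in> carrier_vec I3" "vnorm u3 = 1"
    by (rule svd_first_singular_pair[OF assms(6) M3(2,1)]) (use pos in auto)

  define V1 where "V1 = unvec I2 I3 v1"
  have V1_index: "V1 $$ (j, k) = v1 $ (k * I2 + j)" if "j < I2" "k < I3" for j k
    using that by (simp add: V1_def unvec_def)
  have V1: "V1 \<in> carrier_mat I2 I3" "elements_mat V1 \<subseteq> K"
    by (auto simp: V1_def unvec_def intro!: v1K index_pair_less dest!: elements_matD)
  define u where "u = first_left_sv svd V1"
  define v where "v = first_right_sv svd V1"
  obtain t where t: "0 \<le> t" and u: "u \<in> carrier_vec I2" "vnorm u = 1"
    and v: "v \<in> carrier_vec I3" "vnorm v = 1"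
    and uV1: "\<And>k. k < I3 \<Longrightarrow> (\<Sum>j<I2. cnj (u $ j) * V1 $$ (j, k)) = of_real t * cnj (v $ k)"
    and V1_le: "\<And>y. y \<in> carrier_vec I3 \<Longrightarrow> vnorm (V1 *\<^sub>v y) \<le> t * vnorm y"
    unfolding u_def v_def
    by (rule svd_first_singular_pair[OF assms(6) V1(2,1)]) (use pos in auto)

  define l where "l = tensor_inner I1 I2 I3 T (outer3 u1 u2 u3)"
  define w where "w = kron_vec (conjugate v) u"
  define z where "z = M *\<^sub>v w"
  have th: "thosvd svd I1 I2 I3 T = (\<lambda>i j k. l * outer3 u1 u2 u3 i j k)"
    by (simp add: thosvd_def Let_def l_def u1_def u2_eq u3_eq M_def)
  have se: "seroap svd I1 I2 I3 T = fold1 I2 (outer_conj z w)"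
    by (simp add: seroap_def Let_def z_def w_def u_def v_def V1_def v1_def M_def)

  \<comment> \<open>Contracting the first mode with \<open>u1\<close> reduces the tensor problem to the matrix \<open>V1\<close>.\<close>
  have contract: "tensor_inner I1 I2 I3 T (outer3 u1 b c)
    = of_real s * cnj ((V1 *\<^sub>v c) \<bullet>c conjugate b)"
    if b: "b \<in> carrier_vec I2" and c: "c \<in> carrier_vec I3" for b c
  proof -
    have "(\<Sum>i<I1. cnj (u1 $ i) * T i j k) = of_real s * cnj (V1 $$ (j, k))"
      if "j < I2" "k < I3" for j k
      using u1M[OF index_pair_less[OF that]] that index_pair_less[OF that]
      by (simp add: M_def unfold1_def V1_index)
    then have "tensor_inner I1 I2 I3 T (outer3 u1 b c)
      = (\<Sum>j<I2. \<Sum>k<I3. of_real s * cnj (V1 $$ (j, k)) * cnj (b $ j) * cnj (c $ k))"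
      unfolding tensor_inner_outer3 by (intro sum.cong refl) simp
    also have "\<dots> = of_real s * cnj ((V1 *\<^sub>v c) \<bullet>c conjugate b)"
      using b c V1(1)
      by (simp add: scalar_prod_def atLeast0LessThan sum_distrib_left sum_distrib_right ac_simps)
    finally show ?thesis .
  qed

  have "cmod l \<le> s * t"
  proof -
    have "cmod ((V1 *\<^sub>v u3) \<bullet>c conjugate u2) \<le> vnorm (V1 *\<^sub>v u3) * vnorm (conjugate u2)"
      using V1 u2 u3 by (intro cauchy_schwarz[of _ I2]) auto
    also have "\<dots> \<le> t" using V1_le[of u3] u2 u3 by simp
    finally show ?thesis
      using s by (simp add: l_def contract u2 u3 norm_mult mult_left_mono)
  qed
  also have "s * t \<le> vnorm z"
  proof -
    have z: "z = vec I1 (\<lambda>i. \<Sum>j<I2. \<Sum>k<I3. T i j k * u $ j * cnj (v $ k))"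
      using u v unfolding z_def w_def M_def
      by (subst unfold1_mult_kron_vec) (auto simp: conjugate_complex_def)
    have "(V1 *\<^sub>v v) \<bullet>c u = (\<Sum>j<I2. \<Sum>k<I3. (cnj (u $ j) * V1 $$ (j, k)) * v $ k)"
      using u v V1(1)
      by (simp add: scalar_prod_def conjugate_complex_def atLeast0LessThan sum_distrib_left ac_simps)
    also have "\<dots> = (\<Sum>k<I3. (\<Sum>j<I2. cnj (u $ j) * V1 $$ (j, k)) * v $ k)"
      by (subst sum.swap) (rule sum.cong[OF refl], rule sum_distrib_right[symmetric])
    also have "\<dots> = of_real t * (v \<bullet>c v)"
      using v by (simp add: uV1 scalar_prod_def conjugate_complex_def atLeast0LessThan
          sum_distrib_left ac_simps)
    also have "\<dots> = of_real t" using v by (simp add: cscalar_prod_self)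
    finally have "tensor_inner I1 I2 I3 T (outer3 u1 (conjugate u) v) = of_real (s * t)"
      using u v by (simp add: contract)
    moreover have "tensor_inner I1 I2 I3 T (outer3 u1 (conjugate u) v) = z \<bullet>c u1"
      using u u1 by (simp add: z tensor_inner_def outer3_def scalar_prod_def
          conjugate_complex_def atLeast0LessThan sum_distrib_left ac_simps)
    moreover have "cmod (z \<bullet>c u1) \<le> vnorm z * vnorm u1"
      using u1 by (intro cauchy_schwarz[of _ I1]) (auto simp: z)
    ultimately show ?thesis using s t u1 by (simp add: norm_mult)
  qed
  finally have "(cmod l)\<^sup>2 \<le> (vnorm z)\<^sup>2" by (intro power_mono) auto
  then show ?thesis
    unfolding th se l_def z_def w_def M_def
    by (simp add: scaled_rank1_residual[OF u1 u2 u3] seroap_residual[OF u v])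
qed

end
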